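(* Let $s\ge 2$. The parameterized problem $s$-Multiway Cut[local solution] does not admit a boundaried kernelization (of any computable size $f$), when gluing equivalence is required with respect to all glued annotated boundaried graphs $(H_B,T_H)$ with $T_H\subseteq V(H)$ arbitrary (in particular, $T_H$ may contain boundary vertices).
   Context: All graphs are finite, simple, undirected. A boundaried graph $G_B$ is a graph $G$ with a set $B\subseteq V(G)$ (the boundary). For boundaried graphs $G_B,H_B$ with $V(G)\cap V(H)=B$, the glued graph $G_B\oplus H_B$ has vertex set $V(G)\cup V(H)$ and edge set $E(G)\cup E(H)$; for annotated boundaried graphs $(G_B,T_G)$, $(H_B,T_H)$ with $T_G\subseteq V(G)$, $T_H\subseteq V(H)$, the gluing is $(G_B\oplus H_B,T_G\cup T_H)$. $s$-Multiway Cut ($s$ a fixed constant) is the minimization problem: given a graph $G$ and terminal set $T\subseteq V(G)$, a feasible solution is a set $S\subseteq V(G)\setminus T$ such that $|T|\le s$ and $G-S$ contains no path between two distinct vertices of $T$; its value is $|S|$; $\mathrm{OPT}=+\infty$ if there is no feasible solution. Two annotated boundaried graphs $(G_B,T_G)$, $(G'_B,T'_G)$ are gluing equivalent if there is $\Delta\in\mathbb Z$ such that for every admissible $(H_B,T_H)$ (with $V(H)\cap V(G)=V(H)\cap V(G')=B$), $\mathrm{OPT}(G_B\oplus H_B,T_G\cup T_H)=\mathrm{OPT}(G'_B\oplus H_B,T'_G\cup T_H)+\Delta$. A boundaried kernelization for $s$-Multiway Cut[local solution] of size $f$ is a polynomial-time algorithm that, given an annotated boundaried graph $(G_B,T_G)$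 together with a feasible $s$-Multiway Cut solution for $(G,T_G)$ of value $\ell$, outputs a gluing equivalent annotated boundaried graph $(G'_B,T'_G)$ of size at most $f(|B|+\ell)$, together with the offset $\Delta$, where $f$ is a computable function. *)

theory Defs
  imports "HOL-Library.Extended_Real" "HOL-Computational_Algebra.Polynomial"
begin

section \<open>Graphs\<close>

record 'a ugraph =
  verts :: "'a set"
  edges :: "'a set set"

definition simple_graph :: "'a ugraph \<Rightarrow> bool" where
  "simple_graph G \<longleftrightarrow> finite (verts G) \<and> (\<forall>e\<in>edges G. e \<subseteq> verts G \<and> card e = 2)"

definition graph_union :: "'a ugraph \<Rightarrow> 'a ugraph \<Rightarrow> 'a ugraph" where
  "graph_union G H = \<lparr>verts = verts G \<union> verts H, edges = edges G \<union> edges H\<rparr>"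

definition del_verts :: "'a ugraph \<Rightarrow> 'a set \<Rightarrow> 'a ugraph" where
  "del_verts G S = \<lparr>verts = verts G - S, edges = {e \<in> edges G. e \<inter> S = {}}\<rparr>"

definition is_path :: "'a ugraph \<Rightarrow> 'a \<Rightarrow> 'a list \<Rightarrow> 'a \<Rightarrow> bool" where
  "is_path G u p v \<longleftrightarrow>
     p \<noteq> [] \<and> hd p = u \<and> last p = v \<and> distinct p \<and> set p \<subseteq> verts G \<and>
     successively (\<lambda>x y. {x, y} \<in> edges G) p"


section \<open>Multiway Cut\<close>

definition mwc_feasible :: "nat \<Rightarrow> 'a ugraph \<Rightarrow> 'a set \<Rightarrow> 'a set \<Rightarrow> bool" where
  "mwc_feasible s G T S \<longleftrightarrow>
     S \<subseteq> verts G - T \<and> card T \<le> s \<and>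
     (\<forall>u\<in>T. \<forall>v\<in>T. u \<noteq> v \<longrightarrow> \<not> (\<exists>p. is_path (del_verts G S) u p v))"

text \<open>The infimum of the empty set in \<^typ>\<open>enat\<close> is \<open>\<infinity>\<close>, the value of infeasible instances.\<close>

definition mwc_opt :: "nat \<Rightarrow> 'a ugraph \<Rightarrow> 'a set \<Rightarrow> enat" where
  "mwc_opt s G T = (INF S\<in>{S. mwc_feasible s G T S}. enat (card S))"


section \<open>Annotated boundaried graphs\<close>

record 'a abgraph =
  graph :: "'a ugraph"
  bdry :: "'a set"
  terms :: "'a set"

definition wf_abgraph :: "'a abgraph \<Rightarrow> bool" where
  "wf_abgraph X \<longleftrightarrow>
     simple_graph (graph X) \<and> bdry X \<subseteq> verts (graph X) \<and> terms X \<subseteq> verts (graph X)"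

definition glueable :: "'a abgraph \<Rightarrow> 'a abgraph \<Rightarrow> bool" where
  "glueable X Y \<longleftrightarrow> bdry Y = bdry X \<and> verts (graph X) \<inter> verts (graph Y) = bdry X"

definition glued_opt :: "nat \<Rightarrow> 'a abgraph \<Rightarrow> 'a abgraph \<Rightarrow> enat" where
  "glued_opt s X Y = mwc_opt s (graph_union (graph X) (graph Y)) (terms X \<union> terms Y)"

text \<open>Gluing equivalence with offset \<open>d\<close>. The terminals of \<open>Y\<close> are arbitrary vertices of \<open>Y\<close>,
  boundary vertices included. In \<^typ>\<open>ereal\<close>, adding a finite offset to \<open>\<infinity>\<close> gives \<open>\<infinity>\<close>.\<close>

definition gluing_equiv :: "nat \<Rightarrow> 'a abgraph \<Rightarrow> 'a abgraph \<Rightarrow> int \<Rightarrow> bool" where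
  "gluing_equiv s X X' d \<longleftrightarrow>
     bdry X' = bdry X \<and>
     (\<forall>Y. wf_abgraph Y \<and> glueable X Y \<and> glueable X' Y \<longrightarrow>
        ereal_of_enat (glued_opt s X Y) = ereal_of_enat (glued_opt s X' Y) + ereal (real_of_int d))"

text \<open>Size counts vertices and edges rather than the encoding length: the output has to keep the
  names of the boundary vertices, and these are unbounded in terms of the parameter.\<close>

definition ab_size :: "'a abgraph \<Rightarrow> nat" where
  "ab_size X = card (verts (graph X)) + card (edges (graph X))"


section \<open>Turing machines\<close>

text \<open>Deterministic machines with one two-way infinite tape. States and tape symbols are initial
  segments of the natural numbers; state \<open>0\<close> is initial, state \<open>1\<close> is halting, symbol \<open>0\<close> is
  blank, and symbols \<open>1\<close> to \<open>4\<close> are the input and output alphabet. A transition yields the new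
  state, the symbol written, and the head displacement.\<close>

record tm =
  nstates :: nat
  nsyms :: nat
  delta :: "nat \<Rightarrow> nat \<Rightarrow> nat \<times> nat \<times> int"

definition wf_tm :: "tm \<Rightarrow> bool" where
  "wf_tm M \<longleftrightarrow>
     2 \<le> nstates M \<and> 5 \<le> nsyms M \<and>
     (\<forall>q<nstates M. \<forall>a<nsyms M.
        delta M q a \<in> {..<nstates M} \<times> {..<nsyms M} \<times> {-1, 0, 1})"

type_synonym tm_config = "nat \<times> int \<times> (int \<Rightarrow> nat)"

fun tm_step :: "tm \<Rightarrow> tm_config \<Rightarrow> tm_config" where
  "tm_step M (q, i, tp) =
     (if q = 1 then (q, i, tp)
      else case delta M q (tp i) of (q', a, m) \<Rightarrow> (q', i + m, tp(i := a)))"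

definition tape_of :: "nat list \<Rightarrow> int \<Rightarrow> nat" where
  "tape_of w = (\<lambda>i. if 0 \<le> i \<and> i < int (length w) then w ! nat i else 0)"

text \<open>Halting configurations are fixed points of \<^const>\<open>tm_step\<close>, so being halted after exactly
  \<open>t\<close> iterations means having halted within \<open>t\<close> steps.\<close>

definition tm_computes_within :: "tm \<Rightarrow> nat list \<Rightarrow> nat list \<Rightarrow> nat \<Rightarrow> bool" where
  "tm_computes_within M w u t \<longleftrightarrow>
     (\<exists>i. (tm_step M ^^ t) (0, 0, tape_of w) = (1, i, tape_of u))"


section \<open>Encodings\<close>

text \<open>Symbols \<open>1\<close> and \<open>2\<close> are the binary digits \<open>0\<close> and \<open>1\<close> (least significant digit first),
  \<open>3\<close> terminates a number, and \<open>4\<close> terminates a list of numbers. A graph is given by its vertex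
  list followed by the adjacency lists of its vertices, all in increasing order.\<close>

fun bin_digits :: "nat \<Rightarrow> nat list" where
  "bin_digits n = (if n = 0 then [] else (1 + n mod 2) # bin_digits (n div 2))"

declare bin_digits.simps [simp del]

definition enc_nat :: "nat \<Rightarrow> nat list" where
  "enc_nat n = bin_digits n @ [3]"

definition enc_int :: "int \<Rightarrow> nat list" where
  "enc_int d = (if d < 0 then 2 else 1) # enc_nat (nat \<bar>d\<bar>)"

definition enc_set :: "nat set \<Rightarrow> nat list" where
  "enc_set A = concat (map enc_nat (sorted_list_of_set A)) @ [4]"

definition enc_graph :: "nat ugraph \<Rightarrow> nat list" where
  "enc_graph G =
     enc_set (verts G) @
     concat (map (\<lambda>u. enc_set {v. {u, v} \<in> edges G}) (sorted_list_of_set (verts G)))"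

definition enc_abgraph :: "nat abgraph \<Rightarrow> nat list" where
  "enc_abgraph X = enc_graph (graph X) @ enc_set (bdry X) @ enc_set (terms X)"


section \<open>Boundaried kernelization\<close>

definition computable :: "(nat \<Rightarrow> nat) \<Rightarrow> bool" where
  "computable f \<longleftrightarrow>
     (\<exists>M. wf_tm M \<and> (\<forall>n. \<exists>t. tm_computes_within M (enc_nat n) (enc_nat (f n)) t))"

text \<open>The input is an annotated boundaried graph together with a feasible solution \<open>S\<close> for it,
  and the parameter is the boundary size plus the value of \<open>S\<close>.\<close>

definition boundaried_kernelization :: "nat \<Rightarrow> (nat \<Rightarrow> nat) \<Rightarrow> tm \<Rightarrow> bool" where
  "boundaried_kernelization s f M \<longleftrightarrow>
     wf_tm M \<and>
     (\<exists>p :: nat poly. \<forall>X S. wf_abgraph X \<and> mwc_feasible s (graph X) (terms X) S \<longrightarrow>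
        (\<exists>X' d. wf_abgraph X' \<and> gluing_equiv s X X' d \<and>
           ab_size X' \<le> f (card (bdry X) + card S) \<and>
           tm_computes_within M (enc_abgraph X @ enc_set S) (enc_abgraph X' @ enc_int d)
             (poly p (length (enc_abgraph X @ enc_set S)))))"

end

theory Submission imports Defs begin

text \<open>The complete bipartite graph \<open>K\<^sub>2\<^sub>,\<^sub>n\<close> whose side of size two is the boundary has no terminals,
  so the empty set is a solution and the parameter is \<open>2\<close>. Gluing on no terminals gives optimum
  \<open>0\<close>, so the offset of any equivalent output is at most \<open>0\<close>. Making both boundary vertices
  terminals gives optimum \<open>n\<close>, which is therefore at most the optimum of the same gluing with the
  output, and so at most its number of vertices. Hence \<open>n\<close> is bounded by \<open>f 2\<close>.\<close>

definition biclique_graph :: "nat \<Rightarrow> nat ugraph" where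
  "biclique_graph n =
     \<lparr>verts = {..<n + 2}, edges = (\<lambda>(b, i). {b, i}) ` ({0, 1} \<times> {2..<n + 2})\<rparr>"

definition biclique_abgraph :: "nat \<Rightarrow> nat abgraph" where
  "biclique_abgraph n = \<lparr>graph = biclique_graph n, bdry = {0, 1}, terms = {}\<rparr>"

text \<open>Gluing this on adds no vertex and no edge to a graph with boundary \<open>B\<close>; it
  only turns the vertices of \<open>T\<close> into terminals.\<close>

definition edgeless_abgraph :: "'a set \<Rightarrow> 'a set \<Rightarrow> 'a abgraph" where
  "edgeless_abgraph B T = \<lparr>graph = \<lparr>verts = B, edges = {}\<rparr>, bdry = B, terms = T\<rparr>"

lemma mwc_opt_le:
  "mwc_feasible s G T S \<Longrightarrow> mwc_opt s G T \<le> enat (card S)"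
  unfolding mwc_opt_def by (rule INF_lower) simp

lemma mwc_opt_le_card_verts:
  assumes "finite (verts G)" and "mwc_opt s G T \<noteq> \<infinity>"
  shows "mwc_opt s G T \<le> enat (card (verts G))"
proof -
  \<comment> \<open>The infimum over an empty set is \<open>\<infinity>\<close>, so a finite optimum
    guarantees a feasible solution; any such solution is a set of vertices.\<close>
  obtain S where S: "mwc_feasible s G T S"
    using assms(2) unfolding mwc_opt_def by (cases "{S. mwc_feasible s G T S} = {}") (auto simp: top_enat_def)
  then have "card S \<le> card (verts G)"
    using assms(1) by (intro card_mono) (auto simp: mwc_feasible_def)
  then show ?thesis
    using mwc_opt_le[OF S] by (meson enat_ord_simps(1) order_trans)
qed

lemma mwc_opt_no_terminals: "mwc_opt s G {} = 0"
  using mwc_opt_le[of s G "{}" "{}"] by (simp add: mwc_feasible_def zero_enat_def[symmetric])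

lemma wf_biclique_abgraph: "wf_abgraph (biclique_abgraph n)"
  by (auto simp: wf_abgraph_def biclique_abgraph_def simple_graph_def biclique_graph_def)

lemma wf_edgeless_abgraph:
  "finite B \<Longrightarrow> T \<subseteq> B \<Longrightarrow> wf_abgraph (edgeless_abgraph B T)"
  by (simp add: wf_abgraph_def edgeless_abgraph_def simple_graph_def)

lemma glueable_edgeless_abgraph:
  "wf_abgraph X \<Longrightarrow> glueable X (edgeless_abgraph (bdry X) T)"
  by (auto simp: wf_abgraph_def edgeless_abgraph_def glueable_def)

lemma glued_opt_edgeless_abgraph:
  assumes "wf_abgraph X"
  shows "glued_opt s X (edgeless_abgraph (bdry X) T) = mwc_opt s (graph X) (terms X \<union> T)"
proof -
  have "graph_union (graph X) (graph (edgeless_abgraph (bdry X) T)) = graph X"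
    using assms by (simp add: wf_abgraph_def edgeless_abgraph_def graph_union_def Un_absorb2)
  then show ?thesis
    by (simp add: glued_opt_def edgeless_abgraph_def)
qed

text \<open>Reduces equivalence to a comparison of \<open>X\<close> and \<open>X'\<close>
  themselves. Both have the same boundary, so one edgeless graph on it is glueable to both and
  leaves both graphs unchanged.\<close>

lemma gluing_equiv_terminals:
  assumes "wf_abgraph X" "wf_abgraph X'" "gluing_equiv s X X' d" "T \<subseteq> bdry X"
  shows "ereal_of_enat (mwc_opt s (graph X) (terms X \<union> T)) =
    ereal_of_enat (mwc_opt s (graph X') (terms X' \<union> T)) + ereal (real_of_int d)"
proof -
  let ?Y = "edgeless_abgraph (bdry X) T"
  have B: "bdry X' = bdry X"
    using assms(3) by (simp add: gluing_equiv_def)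
  have "finite (bdry X)"
    using assms(1) by (auto simp: wf_abgraph_def simple_graph_def intro: finite_subset)
  then have "wf_abgraph ?Y" "glueable X ?Y" "glueable X' ?Y"
    using assms glueable_edgeless_abgraph[of X T] glueable_edgeless_abgraph[of X' T]
    by (simp_all add: wf_edgeless_abgraph B)
  then have "ereal_of_enat (glued_opt s X ?Y) =
      ereal_of_enat (glued_opt s X' ?Y) + ereal (real_of_int d)"
    using assms(3) unfolding gluing_equiv_def by blast
  then show ?thesis
    using glued_opt_edgeless_abgraph[OF assms(1), of s T]
      glued_opt_edgeless_abgraph[OF assms(2), of s T]
    by (simp add: B)
qed

text \<open>Deleting the large side removes every edge. Conversely, each of its \<open>n\<close>
  vertices is the sole inner vertex of a path from \<open>0\<close> to \<open>1\<close>, so every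
  solution contains them all. Two terminals are admissible as \<open>s \<ge> 2\<close>.\<close>

lemma mwc_opt_biclique:
  assumes "s \<ge> 2"
  shows "mwc_opt s (biclique_graph n) {0, 1} = enat n"
proof (rule antisym)
  have "\<not> is_path (del_verts (biclique_graph n) {2..<n + 2}) u p v" if "u \<noteq> v" for u p v
  proof
    assume p: "is_path (del_verts (biclique_graph n) {2..<n + 2}) u p v"
    have "edges (del_verts (biclique_graph n) {2..<n + 2}) = {}"
      by (auto simp: del_verts_def biclique_graph_def)
    with p that show False
      \<comment> \<open>The rule splits lists into empty, singleton and longer ones: a singleton
        would force \<open>u = v\<close>, and a longer path needs an edge.\<close>
      by (cases p rule: remdups_adj.cases) (simp_all add: is_path_def)
  qed
  then have "mwc_feasible s (biclique_graph n) {0, 1} {2..<n + 2}"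
    using assms by (auto simp: mwc_feasible_def biclique_graph_def)
  from mwc_opt_le[OF this] show "mwc_opt s (biclique_graph n) {0, 1} \<le> enat n"
    by simp
next
  have "n \<le> card S" if S: "mwc_feasible s (biclique_graph n) {0, 1} S" for S
  proof -
    have "{2..<n + 2} \<subseteq> S"
    proof
      fix i
      assume i: "i \<in> {2..<n + 2}"
      show "i \<in> S"
      proof (rule ccontr)
        assume "i \<notin> S"
        moreover have "0 \<notin> S" "1 \<notin> S"
          using S by (auto simp: mwc_feasible_def)
        moreover have "{0, i} \<in> edges (biclique_graph n)" "{i, 1} \<in> edges (biclique_graph n)"
          \<comment> \<open>Edges are images of pairs with the boundary vertex first, so
            \<open>{i, 1}\<close> comes from \<open>(1, i)\<close> after swapping its
            elements.\<close>
          using i rev_image_eqI[of "(0, i)" "{0, 1} \<times> {2..<n + 2}" "{0, i}" "\<lambda>(b, i). {b, i}"]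
            rev_image_eqI[of "(1, i)" "{0, 1} \<times> {2..<n + 2}" "{i, 1}" "\<lambda>(b, i). {b, i}"]
          by (simp_all add: biclique_graph_def insert_commute)
        ultimately have "is_path (del_verts (biclique_graph n) S) 0 [0, i, 1] 1"
          using i by (simp add: is_path_def del_verts_def) (simp add: biclique_graph_def)
        moreover have "\<nexists>p. is_path (del_verts (biclique_graph n) S) 0 p 1"
          using S by (simp add: mwc_feasible_def)
        ultimately show False
          by blast
      qed
    qed
    moreover have "finite S"
      using S by (auto simp: mwc_feasible_def biclique_graph_def intro: finite_subset)
    ultimately show ?thesis
      using card_mono[of S "{2..<n + 2}"] by simp
  qed
  then show "enat n \<le> mwc_opt s (biclique_graph n) {0, 1}"
    unfolding mwc_opt_def by (intro INF_greatest) simp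
qed

lemma gluing_equiv_biclique_size:
  assumes "s \<ge> 2" "wf_abgraph X'" "gluing_equiv s (biclique_abgraph n) X' d"
  shows "n \<le> ab_size X'"
proof -
  let ?opt = "\<lambda>T. mwc_opt s (graph X') (terms X' \<union> T)"
  note equiv = gluing_equiv_terminals[OF wf_biclique_abgraph assms(2,3)]
  have "0 = ereal_of_enat (?opt {}) + ereal (real_of_int d)"
    using equiv[of "{}"] by (simp add: biclique_abgraph_def mwc_opt_no_terminals)
  then have d: "d \<le> 0"
    \<comment> \<open>An infinite optimum would make the sum infinite; a finite one is nonnegative
      and equals \<open>- d\<close>.\<close>
    by (cases "?opt {}") auto
  have n: "ereal (real n) = ereal_of_enat (?opt {0, 1}) + ereal (real_of_int d)"
    using equiv[of "{0, 1}"] mwc_opt_biclique[OF assms(1)] by (simp add: biclique_abgraph_def)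
  \<comment> \<open>The left-hand side is finite, hence so is this optimum, and
    \<open>n = m + d\<close> with \<open>d \<le> 0\<close>.\<close>
  then obtain m where m: "?opt {0, 1} = enat m"
    by (cases "?opt {0, 1}") auto
  with n d have "n \<le> m"
    by simp
  also have "m \<le> card (verts (graph X'))"
    using mwc_opt_le_card_verts[of "graph X'" s "terms X' \<union> {0, 1}"] m assms(2)
    by (simp add: wf_abgraph_def simple_graph_def)
  finally show ?thesis
    by (simp add: ab_size_def)
qed

theorem theorem10:
  fixes s :: nat
  assumes "s \<ge> 2"
  shows "\<not> (\<exists>f M. computable f \<and> boundaried_kernelization s f M)"
proof
  assume "\<exists>f M. computable f \<and> boundaried_kernelization s f M"
  then obtain f M where kernel: "boundaried_kernelization s f M"
    by blast
  \<comment> \<open>Two boundary vertices and the empty solution give parameter \<open>2\<close>, so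
    \<open>n\<close> is chosen one above the promised size \<open>f 2\<close>.\<close>
  let ?X = "biclique_abgraph (Suc (f 2))"
  have "mwc_feasible s (graph ?X) (terms ?X) {}"
    by (simp add: mwc_feasible_def biclique_abgraph_def)
  then obtain X' d where "wf_abgraph X'" "gluing_equiv s ?X X' d"
    and size: "ab_size X' \<le> f (card (bdry ?X) + card ({} :: nat set))"
    using kernel wf_biclique_abgraph[of "Suc (f 2)"] unfolding boundaried_kernelization_def by blast
  then have "Suc (f 2) \<le> ab_size X'"
    using gluing_equiv_biclique_size[OF assms] by blast
  with size show False
    by (simp add: biclique_abgraph_def numeral_2_eq_2)
qed

end
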